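(* Let $\ell_1,\dots,\ell_n:\mathbb{R}^d\to\mathbb{R}$ and $f=\frac1n\sum_{i=1}^n\ell_i$ satisfy Assumptions A and B of the context, and suppose that the problem has full minimizer coherence, i.e. $\sup_{\theta\in\Theta^*}\ell_i(\theta)=\ell_i^*$ for all $i=1,\dots,n$. Let $\{\theta_k\}_{k\ge0}$ be generated by SGD with random sampling with step size $\eta=\frac1L$ from a fixed $\theta_0\in\mathbb{R}^d$. Then for all $B=1,2,\dots$, $$\mathbb{E}\,\mathrm{dist}_{\Theta^*}^2(\theta_{nB})\le\Big(1-\frac{\bar\mu}{L}\Big)^{nB}\mathrm{dist}_{\Theta^*}^2(\theta_0),\qquad \bar\mu:=\frac1n\sum_{i=1}^n\mu_i .$$
   Context: Problem: minimize $f(\theta)=\frac1n\sum_{i=1}^n \ell_i(\theta)$ over $\theta\in\mathbb{R}^d$, where each $\ell_i:\mathbb{R}^d\to\mathbb{R}$ is differentiable. Assumption A (existence): each $\ell_i$ attains its global minimum $\ell_i^*>-\infty$, with nonempty set of global minimizers $\Theta_i^*\subset\mathbb{R}^d$; $f$ attains its global minimum $f^*>-\infty$, with nonempty set of global minimizers $\Theta^*\subset\mathbb{R}^d$. Assumption B: there are constants $L>0$ and $0<\mu_i\le L$ ($i=1,\dots,n$) such that for every $i$: (1) ($L$-smoothness) $\ell_i(x)\le \ell_i(y)+\langle x-y,\nabla\ell_i(y)\rangle+\frac L2\|x-y\|^2$ for all $x,y\in\mathbb{R}^d$; (2) ($\mu_i$-weak strong convexity) $\ell_i(\omega)\ge \ell_i(x)+\langle\omega-x,\nabla\ell_i(x)\rangle+\frac{\mu_i}{2}\|x-\omega\|^2$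 for all $x\in\mathbb{R}^d$ and all $\omega\in\mathrm{proj}_{\Theta_i^*}(x)\cup\mathrm{proj}_{\Theta^*}(x)$, where $\mathrm{proj}_A(x)$ is the set of Euclidean projections (nearest points) of $x$ onto $A$. SGD: $\theta_{k+1}=\theta_k-\eta\nabla\ell_{\xi(k)}(\theta_k)$, $k=0,1,\dots$. Random sampling (with replacement): the indices $\xi(0),\xi(1),\dots$ are independent and uniformly distributed on $\{1,\dots,n\}$; $\mathbb{E}$ is expectation over them. Distance: $\mathrm{dist}_A(\theta)=\inf_{u\in A}\|\theta-u\|$. *)

theory Defs
  imports "HOL-Probability.Probability"
begin

definition grad :: "('a::real_inner \<Rightarrow> real) \<Rightarrow> 'a \<Rightarrow> 'a" where
  "grad g x = (THE D. GDERIV g x :> D)"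

definition minimizers :: "('a \<Rightarrow> real) \<Rightarrow> 'a set" where
  "minimizers g = {x. \<forall>y. g x \<le> g y}"

text \<open>As a real infimum, this is only meaningful for functions that are bounded below, in
  particular for those with \<^term>\<open>minimizers g \<noteq> {}\<close>, in which case it is the minimum.\<close>

definition min_value :: "('a \<Rightarrow> real) \<Rightarrow> real" where
  "min_value g = (INF x. g x)"

text \<open>All nearest points of \<open>A\<close>; \<open>A\<close> need not be convex, so the single-valued
  \<^const>\<open>closest_point\<close> is not what is wanted.\<close>

definition proj_set :: "'a::metric_space set \<Rightarrow> 'a \<Rightarrow> 'a set" where
  "proj_set A x = {u \<in> A. \<forall>v\<in>A. dist x u \<le> dist x v}"

definition avg_loss :: "nat \<Rightarrow> (nat \<Rightarrow> 'a \<Rightarrow> real) \<Rightarrow> 'a \<Rightarrow> real" where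
  "avg_loss n l \<theta> = (1 / real n) * (\<Sum>i=1..n. l i \<theta>)"

definition smooth_fun :: "real \<Rightarrow> ('a::real_inner \<Rightarrow> real) \<Rightarrow> bool" where
  "smooth_fun L g \<longleftrightarrow>
    (\<forall>x y. g x \<le> g y + (x - y) \<bullet> grad g y + L / 2 * (norm (x - y))\<^sup>2)"

definition weakly_strongly_convex ::
    "real \<Rightarrow> 'a::real_inner set \<Rightarrow> ('a \<Rightarrow> real) \<Rightarrow> bool" where
  "weakly_strongly_convex m S g \<longleftrightarrow>
    (\<forall>x. \<forall>\<omega> \<in> proj_set (minimizers g) x \<union> proj_set S x.
       g \<omega> \<ge> g x + (\<omega> - x) \<bullet> grad g x + m / 2 * (norm (x - \<omega>))\<^sup>2)"

text \<open>The supremum is taken in the extended reals, since a loss need not be bounded above on the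
  set of minimizers of the average.\<close>

definition full_minimizer_coherence :: "nat \<Rightarrow> (nat \<Rightarrow> 'a \<Rightarrow> real) \<Rightarrow> bool" where
  "full_minimizer_coherence n l \<longleftrightarrow>
    (\<forall>i\<in>{1..n}. (SUP \<theta>\<in>minimizers (avg_loss n l). ereal (l i \<theta>)) = ereal (min_value (l i)))"

text \<open>The iterates for one fixed sequence \<open>s\<close> of sampled indices.\<close>

primrec sgd :: "real \<Rightarrow> (nat \<Rightarrow> 'a::real_inner \<Rightarrow> real) \<Rightarrow> 'a \<Rightarrow> (nat \<Rightarrow> nat) \<Rightarrow> nat \<Rightarrow> 'a" where
  "sgd \<eta> l \<theta>\<^sub>0 s 0 = \<theta>\<^sub>0"
| "sgd \<eta> l \<theta>\<^sub>0 s (Suc k) =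
     sgd \<eta> l \<theta>\<^sub>0 s k - \<eta> *\<^sub>R grad (l (s k)) (sgd \<eta> l \<theta>\<^sub>0 s k)"

definition random_sampling :: "'w measure \<Rightarrow> nat \<Rightarrow> (nat \<Rightarrow> 'w \<Rightarrow> nat) \<Rightarrow> bool" where
  "random_sampling M n \<xi> \<longleftrightarrow>
    prob_space.indep_vars M (\<lambda>_. count_space UNIV) \<xi> UNIV \<and>
    (\<forall>k. distr M (count_space UNIV) (\<xi> k) = measure_pmf (pmf_of_set {1..n}))"

end

theory Submission
  imports Defs
begin

text \<open>Full minimizer coherence forces every minimizer of the average to minimize each single loss
  as well. One gradient step of length \<open>1 / L\<close> on the loss \<open>l i\<close> therefore contracts the
  squared distance to \<open>\<Theta>\<close> by the factor \<open>1 - \<mu> i / L\<close>, whatever the current point is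
  (\<open>gradient_step_contracts\<close>): weak strong convexity says that the gradient points away from
  the projection \<open>\<omega>\<close> of the iterate by at least the optimality gap \<open>l i x - l i \<omega>\<close> plus a
  multiple of the squared distance, while the unwanted quadratic term of the step is paid for by the
  same gap, because \<open>L\<close>-smoothness bounds the squared gradient by \<open>2 * L\<close> times the gap.

  Since the contraction holds for every index and every point, no conditioning on the past is
  needed: along each sequence of indices the squared distance is at most the initial one
  times \<open>\<Prod>j<k. 1 - \<mu> (\<xi> j) / L\<close>. The factors are independent and each has mean
  \<open>1 - \<mu>bar / L\<close>, so the expected product is the power in the claim.\<close>

lemma minimizers_avg_loss_subset:
  assumes coh: "full_minimizer_coherence n l"
    and i: "i \<in> {1..n}"
    and ne: "minimizers (l i) \<noteq> {}"
  shows "minimizers (avg_loss n l) \<subseteq> minimizers (l i)"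
proof
  fix \<omega> assume \<omega>: "\<omega> \<in> minimizers (avg_loss n l)"
  have bdd: "bdd_below (range (l i))"
    using ne by (auto simp: minimizers_def bdd_below_def)
  have "ereal (l i \<omega>) \<le> (SUP \<theta>\<in>minimizers (avg_loss n l). ereal (l i \<theta>))"
    using \<omega> by (rule SUP_upper)
  also have "\<dots> = ereal (min_value (l i))"
    using coh i by (auto simp: full_minimizer_coherence_def)
  finally have "l i \<omega> \<le> min_value (l i)" by simp
  moreover have "min_value (l i) \<le> l i y" for y
    unfolding min_value_def by (rule cINF_lower[OF bdd]) simp
  ultimately show "\<omega> \<in> minimizers (l i)"
    unfolding minimizers_def using order_trans by blast
qed

lemma closed_minimizers:
  assumes "continuous_on UNIV g"
  shows "closed (minimizers g)"
proof -
  have "minimizers g = (\<Inter>y. {x. g x \<le> g y})"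
    by (auto simp: minimizers_def)
  then show ?thesis
    using assms by (auto intro!: closed_INT closed_Collect_le continuous_on_const)
qed

text \<open>The quadratic upper bound on \<open>g\<close> that smoothness gives around \<open>x\<close> is smallest at the point
  reached by a gradient step of length \<open>1 / L\<close>, and its value there cannot lie below the minimum.\<close>

lemma norm_grad_le_optimality_gap:
  fixes g :: "'a::real_inner \<Rightarrow> real"
  assumes "L > 0" and smooth: "smooth_fun L g" and \<omega>: "\<omega> \<in> minimizers g"
  shows "(norm (grad g x))\<^sup>2 \<le> 2 * L * (g x - g \<omega>)"
proof -
  let ?D = "grad g x"
  have "g \<omega> \<le> g (x - (1 / L) *\<^sub>R ?D)"
    using \<omega> by (simp add: minimizers_def)
  also have "\<dots> \<le> g x + (x - (1 / L) *\<^sub>R ?D - x) \<bullet> ?D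
      + L / 2 * (norm (x - (1 / L) *\<^sub>R ?D - x))\<^sup>2"
    using smooth unfolding smooth_fun_def by blast
  also have "\<dots> = g x - (norm ?D)\<^sup>2 / (2 * L)"
    using \<open>L > 0\<close> by (simp add: dot_square_norm field_simps power2_eq_square)
  finally show ?thesis
    using \<open>L > 0\<close> by (simp add: field_simps)
qed

lemma gradient_step_contracts:
  fixes g :: "'a::{real_inner, heine_borel} \<Rightarrow> real"
  assumes "L > 0" and smooth: "smooth_fun L g"
    and wsc: "weakly_strongly_convex m S g"
    and S: "closed S" "S \<noteq> {}" "S \<subseteq> minimizers g"
  shows "(infdist (x - (1 / L) *\<^sub>R grad g x) S)\<^sup>2 \<le> (1 - m / L) * (infdist x S)\<^sup>2"
proof -
  let ?D = "grad g x"
  obtain \<omega> where \<omega>: "\<omega> \<in> S" "infdist x S = dist x \<omega>"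
    using infdist_attains_inf[OF S(1,2)] by blast
  then have "\<omega> \<in> proj_set S x"
    by (auto simp: proj_set_def intro: infdist_le simp flip: \<omega>(2))
  then have "g x + (\<omega> - x) \<bullet> ?D + m / 2 * (norm (x - \<omega>))\<^sup>2 \<le> g \<omega>"
    using wsc by (auto simp: weakly_strongly_convex_def)
  then have convex: "g x - g \<omega> + m / 2 * (norm (x - \<omega>))\<^sup>2 \<le> (x - \<omega>) \<bullet> ?D"
    by (simp add: inner_diff_left)
  have grad_le: "(norm ?D)\<^sup>2 \<le> 2 * L * (g x - g \<omega>)"
    using norm_grad_le_optimality_gap[OF \<open>L > 0\<close> smooth] \<omega>(1) S(3) by blast
  have "(infdist (x - (1 / L) *\<^sub>R ?D) S)\<^sup>2 \<le> (norm (x - \<omega> - (1 / L) *\<^sub>R ?D))\<^sup>2"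
    using infdist_le[OF \<omega>(1), of "x - (1 / L) *\<^sub>R ?D"]
    by (intro power_mono) (auto simp: dist_norm algebra_simps infdist_nonneg)
  also have "\<dots> = (norm (x - \<omega>))\<^sup>2 - 2 / L * ((x - \<omega>) \<bullet> ?D) + (norm ?D)\<^sup>2 / L\<^sup>2"
    unfolding power2_norm_eq_inner
    by (simp add: inner_diff inner_commute power2_eq_square algebra_simps)
  also have "\<dots> \<le> (norm (x - \<omega>))\<^sup>2 - 2 / L * (g x - g \<omega> + m / 2 * (norm (x - \<omega>))\<^sup>2)
      + 2 * L * (g x - g \<omega>) / L\<^sup>2"
    using \<open>L > 0\<close> convex grad_le
    by (intro add_mono diff_mono mult_left_mono divide_right_mono) auto
  also have "\<dots> = (1 - m / L) * (norm (x - \<omega>))\<^sup>2"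
    using \<open>L > 0\<close> by (simp add: field_simps power2_eq_square)
  finally show ?thesis
    by (simp add: \<omega>(2) dist_norm)
qed

lemma infdist_sgd_le:
  fixes l :: "nat \<Rightarrow> 'a::{real_inner, heine_borel} \<Rightarrow> real"
  assumes "L > 0" "closed S" "S \<noteq> {}"
    and "\<And>i. i \<in> I \<Longrightarrow> \<mu> i \<le> L"
    and "\<And>i. i \<in> I \<Longrightarrow> smooth_fun L (l i)"
    and "\<And>i. i \<in> I \<Longrightarrow> weakly_strongly_convex (\<mu> i) S (l i)"
    and "\<And>i. i \<in> I \<Longrightarrow> S \<subseteq> minimizers (l i)"
    and s: "\<And>j. j < k \<Longrightarrow> s j \<in> I"
  shows "(infdist (sgd (1 / L) l \<theta>\<^sub>0 s k) S)\<^sup>2 \<le> (\<Prod>j<k. 1 - \<mu> (s j) / L) * (infdist \<theta>\<^sub>0 S)\<^sup>2"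
  using s
proof (induction k)
  case 0
  then show ?case by simp
next
  case (Suc k)
  have sk: "s k \<in> I" using Suc.prems by simp
  have "(infdist (sgd (1 / L) l \<theta>\<^sub>0 s (Suc k)) S)\<^sup>2
      \<le> (1 - \<mu> (s k) / L) * (infdist (sgd (1 / L) l \<theta>\<^sub>0 s k) S)\<^sup>2"
    using gradient_step_contracts[of L "l (s k)" "\<mu> (s k)" S] assms sk by simp
  also have "\<dots> \<le> (1 - \<mu> (s k) / L) * ((\<Prod>j<k. 1 - \<mu> (s j) / L) * (infdist \<theta>\<^sub>0 S)\<^sup>2)"
    using assms(1,4) sk Suc by (intro mult_left_mono) auto
  finally show ?case by (simp add: mult_ac)
qed

text \<open>The gradients and \<open>h\<close> may be arbitrary, non-measurable functions of the parameter, because the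
  iterate depends on finitely many indices only and is thus a discrete random variable.\<close>

lemma measurable_sgd:
  assumes \<xi>: "\<And>j. \<xi> j \<in> measurable M (count_space UNIV)"
    and h: "\<And>x. h x \<in> space N"
  shows "(\<lambda>w. h (sgd \<eta> l \<theta>\<^sub>0 (\<lambda>j. \<xi> j w) k)) \<in> measurable M N"
  using h
proof (induction k arbitrary: h)
  case 0
  then show ?case by simp
next
  case (Suc k)
  \<comment> \<open>For each of the countably many values \<open>i\<close> of the last index, the last step is
    absorbed into \<open>h\<close>; this is why \<open>h\<close> has to be arbitrary.\<close>
  have "(\<lambda>w. (\<lambda>x. h (x - \<eta> *\<^sub>R grad (l i) x)) (sgd \<eta> l \<theta>\<^sub>0 (\<lambda>j. \<xi> j w) k)) \<in> measurable M N"
    for i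
    by (rule Suc.IH) (rule Suc.prems)
  from measurable_compose_countable[OF this \<xi>[of k]] show ?case by simp
qed

context prob_space
begin

lemma random_sampling_AE:
  assumes "random_sampling M n \<xi>" "n \<ge> 1"
  shows "AE w in M. \<forall>j. \<xi> j w \<in> {1..n}"
proof -
  have meas: "\<xi> j \<in> measurable M (count_space UNIV)" for j
    using assms unfolding random_sampling_def indep_vars_def by auto
  have "AE w in M. \<xi> j w \<in> {1..n}" for j
  proof -
    have "AE i in distr M (count_space UNIV) (\<xi> j). i \<in> {1..n}"
    proof -
      have "distr M (count_space UNIV) (\<xi> j) = measure_pmf (pmf_of_set {1..n})"
        using assms by (simp add: random_sampling_def)
      then show ?thesis
        using \<open>n \<ge> 1\<close> by (simp only: AE_measure_pmf_iff) (simp add: set_pmf_of_set)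
    qed
    then show ?thesis
      by (subst (asm) AE_distr_iff[OF meas]) auto
  qed
  then show ?thesis by (simp add: AE_all_countable)
qed

lemma random_sampling_expectation:
  fixes g :: "nat \<Rightarrow> real"
  assumes rs: "random_sampling M n \<xi>" and "n \<ge> 1"
  shows "integrable M (\<lambda>w. g (\<xi> j w))"
    and "expectation (\<lambda>w. g (\<xi> j w)) = (\<Sum>i=1..n. g i) / real n"
proof -
  have meas: "\<xi> j \<in> measurable M (count_space UNIV)"
    using rs unfolding random_sampling_def indep_vars_def by auto
  have distr: "distr M (count_space UNIV) (\<xi> j) = measure_pmf (pmf_of_set {1..n})"
    using rs by (simp add: random_sampling_def)
  have "integrable (measure_pmf (pmf_of_set {1..n})) g"
    using \<open>n \<ge> 1\<close> by (intro integrable_measure_pmf_finite) (simp add: set_pmf_of_set)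
  then show "integrable M (\<lambda>w. g (\<xi> j w))"
    unfolding distr[symmetric] by (rule integrable_distr[OF meas])
  have "expectation (\<lambda>w. g (\<xi> j w)) = integral\<^sup>L (measure_pmf (pmf_of_set {1..n})) g"
    unfolding distr[symmetric] by (rule integral_distr[symmetric, OF meas]) simp
  also have "\<dots> = (\<Sum>i=1..n. g i) / real n"
    using \<open>n \<ge> 1\<close> by (subst integral_pmf_of_set) auto
  finally show "expectation (\<lambda>w. g (\<xi> j w)) = (\<Sum>i=1..n. g i) / real n" .
qed

lemma random_sampling_expectation_prod:
  fixes g :: "nat \<Rightarrow> real"
  assumes rs: "random_sampling M n \<xi>" and "n \<ge> 1"
  shows "integrable M (\<lambda>w. \<Prod>j<k. g (\<xi> j w))"
    and "expectation (\<lambda>w. \<Prod>j<k. g (\<xi> j w)) = ((\<Sum>i=1..n. g i) / real n) ^ k"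
proof -
  have "indep_vars (\<lambda>_. count_space UNIV) \<xi> {..<k}"
    using rs indep_vars_subset unfolding random_sampling_def by blast
  then have indep: "indep_vars (\<lambda>_. borel) (\<lambda>j w. g (\<xi> j w)) {..<k}"
    by (rule indep_vars_compose2) simp
  note expect = random_sampling_expectation[OF assms, of g]
  show "integrable M (\<lambda>w. \<Prod>j<k. g (\<xi> j w))"
    using indep_vars_integrable[OF _ indep] expect(1) by simp
  show "expectation (\<lambda>w. \<Prod>j<k. g (\<xi> j w)) = ((\<Sum>i=1..n. g i) / real n) ^ k"
    using indep_vars_lebesgue_integral[OF _ indep] expect by simp
qed

end

theorem proposition3:
  fixes l :: "nat \<Rightarrow> real ^ 'd \<Rightarrow> real"
    and n :: nat
    and L :: real
    and \<mu> :: "nat \<Rightarrow> real"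
    and M :: "'w measure"
    and \<xi> :: "nat \<Rightarrow> 'w \<Rightarrow> nat"
    and \<theta>\<^sub>0 :: "real ^ 'd"
    and B :: nat
  defines "\<Theta> \<equiv> minimizers (avg_loss n l)"
    and "\<mu>bar \<equiv> (1 / real n) * (\<Sum>i=1..n. \<mu> i)"
    and "\<theta> \<equiv> (\<lambda>k w. sgd (1 / L) l \<theta>\<^sub>0 (\<lambda>j. \<xi> j w) k)"
  assumes "n \<ge> 1"
    and "\<And>i x. i \<in> {1..n} \<Longrightarrow> l i differentiable (at x)"
    and "\<And>i. i \<in> {1..n} \<Longrightarrow> minimizers (l i) \<noteq> {}"
    and "\<Theta> \<noteq> {}"
    and "L > 0"
    and "\<And>i. i \<in> {1..n} \<Longrightarrow> 0 < \<mu> i \<and> \<mu> i \<le> L"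
    and "\<And>i. i \<in> {1..n} \<Longrightarrow> smooth_fun L (l i)"
    and "\<And>i. i \<in> {1..n} \<Longrightarrow> weakly_strongly_convex (\<mu> i) \<Theta> (l i)"
    and "full_minimizer_coherence n l"
    and "prob_space M"
    and "random_sampling M n \<xi>"
    and "B \<ge> 1"
  shows "integrable M (\<lambda>w. (infdist (\<theta> (n * B) w) \<Theta>)\<^sup>2) \<and>
    prob_space.expectation M (\<lambda>w. (infdist (\<theta> (n * B) w) \<Theta>)\<^sup>2)
      \<le> (1 - \<mu>bar / L) ^ (n * B) * (infdist \<theta>\<^sub>0 \<Theta>)\<^sup>2"
proof -
  interpret prob_space M by fact
  define k where "k = n * B"
  define P where "P = (\<lambda>w. \<Prod>j<k. 1 - \<mu> (\<xi> j w) / L)"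
  have rs: "random_sampling M n \<xi>" by fact
  have "continuous_on UNIV (l i)" if "i \<in> {1..n}" for i
    using assms(5)[OF that]
    by (simp add: continuous_on_eq_continuous_within differentiable_imp_continuous_within)
  then have "closed \<Theta>"
    unfolding \<Theta>_def avg_loss_def by (intro closed_minimizers continuous_intros) auto
  have sub: "\<Theta> \<subseteq> minimizers (l i)" if "i \<in> {1..n}" for i
    unfolding \<Theta>_def using minimizers_avg_loss_subset assms(6,12) that by blast
  have "(infdist (\<theta> k w) \<Theta>)\<^sup>2 \<le> P w * (infdist \<theta>\<^sub>0 \<Theta>)\<^sup>2" if "\<forall>j. \<xi> j w \<in> {1..n}" for w
    unfolding \<theta>_def P_def
    by (rule infdist_sgd_le[where I = "{1..n}"])
      (use assms(7-11) \<open>closed \<Theta>\<close> that sub in auto)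
  then have bound: "AE w in M. (infdist (\<theta> k w) \<Theta>)\<^sup>2 \<le> P w * (infdist \<theta>\<^sub>0 \<Theta>)\<^sup>2"
    using random_sampling_AE[OF rs \<open>n \<ge> 1\<close>] by auto
  have int_bound: "integrable M (\<lambda>w. P w * (infdist \<theta>\<^sub>0 \<Theta>)\<^sup>2)"
    unfolding P_def
    using random_sampling_expectation_prod(1)[OF rs \<open>n \<ge> 1\<close>, of "\<lambda>i. 1 - \<mu> i / L"] by simp
  have "\<xi> j \<in> measurable M (count_space UNIV)" for j
    using rs unfolding random_sampling_def indep_vars_def by auto
  then have "(\<lambda>w. (infdist (\<theta> k w) \<Theta>)\<^sup>2) \<in> borel_measurable M"
    unfolding \<theta>_def by (rule measurable_sgd) simp
  then have int: "integrable M (\<lambda>w. (infdist (\<theta> k w) \<Theta>)\<^sup>2)"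
    by (rule Bochner_Integration.integrable_bound[OF int_bound])
      (use bound in eventually_elim, auto)
  have "expectation (\<lambda>w. (infdist (\<theta> k w) \<Theta>)\<^sup>2) \<le> expectation (\<lambda>w. P w * (infdist \<theta>\<^sub>0 \<Theta>)\<^sup>2)"
    by (rule integral_mono_AE[OF int int_bound bound])
  also have "\<dots> = ((\<Sum>i=1..n. 1 - \<mu> i / L) / real n) ^ k * (infdist \<theta>\<^sub>0 \<Theta>)\<^sup>2"
    unfolding P_def
    using random_sampling_expectation_prod(2)[OF rs \<open>n \<ge> 1\<close>, of "\<lambda>i. 1 - \<mu> i / L"] by simp
  also have "(\<Sum>i=1..n. 1 - \<mu> i / L) / real n = 1 - \<mu>bar / L"
    using \<open>n \<ge> 1\<close>
    by (simp add: \<mu>bar_def sum_subtractf diff_divide_distrib flip: sum_divide_distrib)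
  finally show ?thesis
    using int by (simp add: k_def)
qed

end
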